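(* Let $A \in M_{n\times n}(\mathbb{R})$ and $C \in K(\mathbb{R}^n)$. Then: (1) The minimax principle for $\lambda(u,v)=\frac{\langle Au,v\rangle}{\langle u,v\rangle}$ is satisfied in $C\times C^o$ and in $C^o\times C$, i.e. $$-\infty<\sup_{u\in C}\inf_{v \in C^o}\lambda(u,v)=\inf_{v \in C^o}\sup_{u \in C}\lambda(u,v)<+\infty,\qquad -\infty<\sup_{u\in C^o}\inf_{v \in C}\lambda(u,v)=\inf_{v \in C}\sup_{u \in C^o}\lambda(u,v)<+\infty.$$ (2) There exist a right quasi-eigenvector $u_C(A)\in C$ and a left quasi-eigenvector $v_C(A)\in C$ of $A$ in $C$. (3) If $u_C(A)\in C^o$, then the minimax principle for $\lambda(u,v)$ is satisfied in $C^o\times C^o$, and $$\overline{\lambda}_C(A)=\lambda_C(A):=\sup_{u\in C^o}\inf_{v \in C^o}\lambda(u,v)=\inf_{v \in C^o}\sup_{u \in C^o}\lambda(u,v).$$ If $v_C(A)\in C^o$, then the minimax principle for $\lambda(u,v)$ is satisfied in $C^o\times C^o$, and $$\underline{\lambda}_C(A)=\lambda_C(A):=\sup_{u\in C^o}\inf_{v \in C^o}\lambda(u,v)=\inf_{v \in C^o}\sup_{u \in C^o}\lambda(u,v).$$ (4) If $u_C(A), v_C(A) \in C^o$, then $\lambda_C(A)=\lambda(u_C(A),v_C(A))$ is an eigenvalue of $A$, and $u_C(A)$, $v_C(A)$ are corresponding right and left eigenvectors of $A$.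
   Context: $M_{n\times n}(\mathbb{R})$ is the space of real $n\times n$ matrices and $\langle\cdot,\cdot\rangle$ is the standard inner product on $\mathbb{R}^n$. $\overline{K}(\mathbb{R}^n)$ is the set of self-dual solid convex cones in $\mathbb{R}^n$: $\overline{C}\in\overline{K}(\mathbb{R}^n)$ if $\alpha u+\beta w\in\overline{C}$ for all $u,w\in\overline{C}$ and $\alpha,\beta\ge 0$; $\overline{C}=\{u\in\mathbb{R}^n\mid \langle w,u\rangle\ge 0\ \forall w\in\overline{C}\}$; and $C^o:=\operatorname{int}\overline{C}\ne\emptyset$. Put $C:=\overline{C}\setminus\{0\}$ and $K(\mathbb{R}^n):=\{C\mid \overline{C}\in\overline{K}(\mathbb{R}^n)\}$. For $A\in M_{n\times n}(\mathbb{R})$, $\lambda(u,v):=\frac{\langle Au,v\rangle}{\langle u,v\rangle}$ for $u,v\in\mathbb{R}^n$ with $\langle u,v\rangle\neq 0$; it is well defined on $C\times C^o$ and on $C^o\times C$. For sets $X,Y\subset\mathbb{R}^n$ such that $\lambda$ is well defined on $X\times Y$, the minimax principle is satisfied in $X\times Y$ if $-\infty<\sup_{u\in X}\inf_{v\in Y}\lambda(u,v)=\inf_{v\in Y}\sup_{u\in X}\lambda(u,v)<+\infty$. The upper and lower quasi-eigenvalues of $A$ in $C$ are $\overline{\lambda}_C(A):=\sup_{u\in C}\inf_{v\in C^o}\lambda(u,v)$ and $\underline{\lambda}_C(A):=\inf_{v\in C}\sup_{u\in C^o}\lambda(u,v)$. A right quasi-eigenvector of $A$ in $C$ is a vector $u_C(A)\in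 C$ with $\overline{\lambda}_C(A)=\inf_{v\in C^o}\lambda(u_C(A),v)$; a left quasi-eigenvector is a vector $v_C(A)\in C$ with $\underline{\lambda}_C(A)=\sup_{u\in C^o}\lambda(u,v_C(A))$. A left eigenvector of $A$ with eigenvalue $\mu$ is a nonzero $v$ with $A^Tv=\mu v$. *)

theory Defs
  imports "HOL-Analysis.Analysis"
begin

definition dual_cone :: "(real^'n) set \<Rightarrow> (real^'n) set" where
  "dual_cone S = {u. \<forall>w\<in>S. 0 \<le> w \<bullet> u}"

definition self_dual_solid_cones :: "(real^'n) set set" where
  "self_dual_solid_cones =
     {S. (\<forall>u\<in>S. \<forall>w\<in>S. \<forall>\<alpha>\<ge>0. \<forall>\<beta>\<ge>0. \<alpha> *\<^sub>R u + \<beta> *\<^sub>R w \<in> S) \<and>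
         S = dual_cone S \<and> interior S \<noteq> {}}"

definition punctured_cones :: "(real^'n) set set" where
  "punctured_cones = {S - {0} | S. S \<in> self_dual_solid_cones}"

(* C^o is the interior of the full cone from which C arose by deleting the origin;
   that cone is recovered from C as insert 0 C, see full_cone_punctured. *)
definition full_cone :: "(real^'n) set \<Rightarrow> (real^'n) set" where
  "full_cone C = insert 0 C"

definition open_cone :: "(real^'n) set \<Rightarrow> (real^'n) set" where
  "open_cone C = interior (full_cone C)"

lemma full_cone_punctured:
  assumes "S \<in> self_dual_solid_cones"
  shows "full_cone (S - {0}) = S"
proof -
  have "S = dual_cone S"
    using assms by (simp add: self_dual_solid_cones_def)
  moreover have "0 \<in> dual_cone S"
    by (simp add: dual_cone_def)
  ultimately have "0 \<in> S"
    by simp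
  then show ?thesis
    by (auto simp: full_cone_def)
qed

definition lam :: "real^'n^'n \<Rightarrow> real^'n \<Rightarrow> real^'n \<Rightarrow> real" where
  "lam A u v = ((A *v u) \<bullet> v) / (u \<bullet> v)"

definition lam_well_defined :: "(real^'n) set \<Rightarrow> (real^'n) set \<Rightarrow> bool" where
  "lam_well_defined X Y \<longleftrightarrow> (\<forall>u\<in>X. \<forall>v\<in>Y. u \<bullet> v \<noteq> 0)"

(* Suprema and infima are taken in the extended reals, since the inner ones may be
   infinite when the outer variable lies on the boundary of the cone. *)
definition sup_inf :: "real^'n^'n \<Rightarrow> (real^'n) set \<Rightarrow> (real^'n) set \<Rightarrow> ereal" where
  "sup_inf A X Y = (SUP u\<in>X. INF v\<in>Y. ereal (lam A u v))"

definition inf_sup :: "real^'n^'n \<Rightarrow> (real^'n) set \<Rightarrow> (real^'n) set \<Rightarrow> ereal" where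
  "inf_sup A X Y = (INF v\<in>Y. SUP u\<in>X. ereal (lam A u v))"

(* Well-definedness of lam on X \<times> Y is a precondition of the minimax principle; it is a
   conjunct here so that the principle never refers to a value x / 0. *)
definition minimax_principle :: "real^'n^'n \<Rightarrow> (real^'n) set \<Rightarrow> (real^'n) set \<Rightarrow> bool" where
  "minimax_principle A X Y \<longleftrightarrow>
     lam_well_defined X Y \<and>
     - \<infinity> < sup_inf A X Y \<and> sup_inf A X Y = inf_sup A X Y \<and> inf_sup A X Y < \<infinity>"

definition upper_quasi_eigenvalue :: "real^'n^'n \<Rightarrow> (real^'n) set \<Rightarrow> ereal" where
  "upper_quasi_eigenvalue A C = sup_inf A C (open_cone C)"

definition lower_quasi_eigenvalue :: "real^'n^'n \<Rightarrow> (real^'n) set \<Rightarrow> ereal" where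
  "lower_quasi_eigenvalue A C = inf_sup A (open_cone C) C"

definition right_quasi_eigenvector :: "real^'n^'n \<Rightarrow> (real^'n) set \<Rightarrow> real^'n \<Rightarrow> bool" where
  "right_quasi_eigenvector A C u \<longleftrightarrow>
     u \<in> C \<and> upper_quasi_eigenvalue A C = (INF v\<in>open_cone C. ereal (lam A u v))"

definition left_quasi_eigenvector :: "real^'n^'n \<Rightarrow> (real^'n) set \<Rightarrow> real^'n \<Rightarrow> bool" where
  "left_quasi_eigenvector A C v \<longleftrightarrow>
     v \<in> C \<and> lower_quasi_eigenvalue A C = (SUP u\<in>open_cone C. ereal (lam A u v))"

definition lam_C :: "real^'n^'n \<Rightarrow> (real^'n) set \<Rightarrow> ereal" where
  "lam_C A C = sup_inf A (open_cone C) (open_cone C)"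

definition right_eigenvector :: "real^'n^'n \<Rightarrow> real \<Rightarrow> real^'n \<Rightarrow> bool" where
  "right_eigenvector A \<mu> u \<longleftrightarrow> u \<noteq> 0 \<and> A *v u = \<mu> *\<^sub>R u"

definition left_eigenvector :: "real^'n^'n \<Rightarrow> real \<Rightarrow> real^'n \<Rightarrow> bool" where
  "left_eigenvector A \<mu> v \<longleftrightarrow> v \<noteq> 0 \<and> transpose A *v v = \<mu> *\<^sub>R v"

definition is_eigenvalue :: "real^'n^'n \<Rightarrow> real \<Rightarrow> bool" where
  "is_eigenvalue A \<mu> \<longleftrightarrow> (\<exists>u. right_eigenvector A \<mu> u)"

end

(* For real t, the inequality t <= inf over v of lambda(u,v) says A u - t u \<in> K, and
   sup over u of lambda(u,v) <= t says t v - A^T v \<in> K, where K is the self-dual cone.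
   A separation argument shows that for every t either A u - t u \<in> K for some nonzero u in K,
   or t v - A^T v \<in> int K for some v in int K; this excludes a duality gap, and, since the
   second alternative is open in t, it also shows that the supremum is attained.
   Passing from A to -A^T swaps the roles of u and v. *)
theory Submission imports Defs begin

section \<open>Duality between the two minimax problems\<close>

lemma inner_transpose_matrix_vector:
  fixes A :: "real^'n^'n"
  shows "(transpose A *v v) \<bullet> u = (A *v u) \<bullet> v"
  by (metis dot_lmul_matrix inner_commute transpose_matrix_vector)

lemma uminus_matrix_vector_mult:
  fixes A :: "real^'n^'n"
  shows "(- A) *v x = - (A *v x)"
  using scaleR_matrix_vector_assoc[of "-1" A x] by simp

text \<open>Transposing swaps the arguments and the sign swaps suprema with infima, so a result on
  \<open>C\<close> times its interior yields its mirror image on the interior times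
  \<open>C\<close>. The identity also holds where \<open>u \<bullet> v = 0\<close>, as both
  quotients are then 0.\<close>

lemma lam_minus_transpose: "lam (- transpose A) v u = - lam A u v"
  by (simp add: lam_def uminus_matrix_vector_mult inner_transpose_matrix_vector inner_commute[of v u]
      del: transpose_matrix_vector)

lemma SUP_lam_minus_transpose:
  "(SUP v\<in>Y. ereal (lam (- transpose A) v u)) = - (INF v\<in>Y. ereal (lam A u v))"
  unfolding lam_minus_transpose
  by (simp flip: uminus_ereal.simps(1) add: ereal_SUP_uminus_eq)

lemma INF_lam_minus_transpose:
  "(INF u\<in>X. ereal (lam (- transpose A) v u)) = - (SUP u\<in>X. ereal (lam A u v))"
  unfolding lam_minus_transpose
  by (simp flip: uminus_ereal.simps(1) add: ereal_INF_uminus_eq)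

lemma sup_inf_minus_transpose: "sup_inf (- transpose A) Y X = - inf_sup A X Y"
  unfolding sup_inf_def inf_sup_def INF_lam_minus_transpose by (simp add: ereal_SUP_uminus_eq)

lemma inf_sup_minus_transpose: "inf_sup (- transpose A) Y X = - sup_inf A X Y"
  unfolding sup_inf_def inf_sup_def SUP_lam_minus_transpose by (simp add: ereal_INF_uminus_eq)

lemma lam_well_defined_commute: "lam_well_defined Y X = lam_well_defined X Y"
  unfolding lam_well_defined_def by (metis inner_commute)

lemma minimax_principle_minus_transpose:
  "minimax_principle (- transpose A) Y X = minimax_principle A X Y"
  unfolding minimax_principle_def sup_inf_minus_transpose inf_sup_minus_transpose
  by (cases "sup_inf A X Y"; cases "inf_sup A X Y") (auto simp: lam_well_defined_commute)

lemma right_quasi_eigenvector_minus_transpose: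
  "right_quasi_eigenvector (- transpose A) C v = left_quasi_eigenvector A C v"
  unfolding right_quasi_eigenvector_def left_quasi_eigenvector_def upper_quasi_eigenvalue_def
    lower_quasi_eigenvalue_def sup_inf_minus_transpose INF_lam_minus_transpose
  by simp

lemma sup_inf_le_inf_sup: "sup_inf A X Y \<le> inf_sup A X Y"
  unfolding sup_inf_def inf_sup_def
  by (intro SUP_least INF_greatest) (meson INF_lower SUP_upper order_trans)

section \<open>Self-dual solid cones\<close>

locale self_dual_solid_cone =
  fixes K :: "(real^'n) set"
  assumes dual_cone_eq: "dual_cone K = K"
    and solid: "interior K \<noteq> {}"
begin

lemma inner_nonneg: "x \<in> K \<Longrightarrow> y \<in> K \<Longrightarrow> 0 \<le> x \<bullet> y"
  using dual_cone_eq by (auto simp: dual_cone_def)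

lemma mem_if_inner_nonneg: "(\<And>w. w \<in> K \<Longrightarrow> 0 \<le> w \<bullet> x) \<Longrightarrow> x \<in> K"
  using dual_cone_eq by (auto simp: dual_cone_def)

lemma zero_mem: "0 \<in> K"
  by (simp add: mem_if_inner_nonneg)

text \<open>By self-duality \<open>K\<close> is an intersection of half-spaces bounded by
  hyperplanes through 0.\<close>

lemma convex: "convex K"
  by (intro convexI mem_if_inner_nonneg) (simp add: inner_add_right inner_nonneg)

text \<open>A convex set with interior points lies in the closure of its interior. Weak linear
  inequalities therefore need checking on \<open>interior K\<close> only.\<close>

lemma subset_closed_if_interior_subset:
  assumes "closed S" "interior K \<subseteq> S"
  shows "K \<subseteq> S"
  by (metis assms closure_minimal closure_subset convex convex_closure_interior order_trans solid)

lemma mem_if_inner_interior_nonneg: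
  assumes "\<And>w. w \<in> interior K \<Longrightarrow> 0 \<le> w \<bullet> x"
  shows "x \<in> K"
proof -
  have "K \<subseteq> {w. x \<bullet> w \<ge> 0}"
    using assms
    by (intro subset_closed_if_interior_subset[OF closed_halfspace_ge]) (auto simp: inner_commute)
  then show ?thesis
    by (auto intro: mem_if_inner_nonneg simp: inner_commute)
qed

text \<open>Openness of the interior along an arbitrary direction \<open>z\<close>. The slack
  \<open>e\<close> is what yields strict inequalities and finite bounds below.\<close>

lemma interior_minus_scaleR:
  assumes "x \<in> interior K"
  obtains e where "e > 0" "x - e *\<^sub>R z \<in> interior K"
proof -
  have "((\<lambda>e. x - e *\<^sub>R z) \<longlongrightarrow> x - 0 *\<^sub>R z) (at_right 0)"
    by (intro tendsto_intros)
  then have "\<forall>\<^sub>F e in at_right 0. x - e *\<^sub>R z \<in> interior K"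
    using assms by (intro topological_tendstoD) auto
  then have "\<forall>\<^sub>F e in at_right 0. 0 < e \<and> x - e *\<^sub>R z \<in> interior K"
    by (intro eventually_conj eventually_at_right_less)
  then show ?thesis
    using that eventually_happens trivial_limit_at_right_real by blast
qed

lemma inner_pos:
  assumes "x \<in> K" "x \<noteq> 0" "y \<in> interior K"
  shows "0 < x \<bullet> y"
proof -
  obtain e where e: "e > 0" "y - e *\<^sub>R x \<in> interior K"
    using assms(3) by (rule interior_minus_scaleR)
  then have "0 \<le> x \<bullet> (y - e *\<^sub>R x)"
    using assms(1) interior_subset by (blast intro: inner_nonneg)
  moreover have "0 < e * (x \<bullet> x)"
    using e assms(2) by simp
  ultimately show ?thesis
    by (simp add: inner_diff_right)
qed

lemma zero_not_interior: "0 \<notin> interior K"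
proof
  assume "0 \<in> interior K"
  \<comment> \<open>The all-ones vector serves as a nonzero direction. A nonzero element of
    \<open>K\<close> would have positive inner product with the interior point 0, which is
    absurd.\<close>
  then obtain e where "e > 0" "0 - e *\<^sub>R (1::real^'n) \<in> interior K"
    by (rule interior_minus_scaleR)
  then have neg: "- (e *\<^sub>R (1::real^'n)) \<in> K" "- (e *\<^sub>R (1::real^'n)) \<noteq> 0"
    using interior_subset by auto
  then show False
    using inner_pos[OF neg \<open>0 \<in> interior K\<close>] by simp
qed

lemma interior_subset_punctured: "interior K \<subseteq> K - {0}"
  using interior_subset zero_not_interior by blast

lemma inner_pos_punctured: "x \<in> K - {0} \<Longrightarrow> y \<in> interior K \<Longrightarrow> 0 < x \<bullet> y"
  using inner_pos by blast

text \<open>If the convex sets \<open>interior K\<close> and its image under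
  \<open>transpose B\<close> are disjoint, a hyperplane separates them, and its normal
  \<open>b\<close> is the required \<open>u\<close>.\<close>

lemma theorem_of_alternative:
  fixes B :: "real^'n^'n"
  shows "(\<exists>u\<in>K - {0}. - (B *v u) \<in> K) \<or> (\<exists>v\<in>interior K. transpose B *v v \<in> interior K)"
proof (rule disjCI)
  assume none: "\<not> (\<exists>v\<in>interior K. transpose B *v v \<in> interior K)"
  \<comment> \<open>\<open>S\<close> is the difference set of the two convex sets; it misses 0
    exactly when they are disjoint.\<close>
  define S where "S = (\<Union>y\<in>interior K. \<Union>x\<in>(*v) (transpose B) ` interior K. {y - x})"
  have "convex S"
    unfolding S_def
    by (intro convex_differences convex_interior convex convex_linear_image
        matrix_vector_mul_linear)
  moreover have "0 \<notin> S"
    using none by (auto simp: S_def)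
  ultimately obtain b where b: "b \<noteq> 0" "\<And>z. z \<in> S \<Longrightarrow> 0 \<le> b \<bullet> z"
    using separating_hyperplane_set_0[of S] by blast
  have le: "(B *v b) \<bullet> x \<le> b \<bullet> y" if "x \<in> interior K" "y \<in> interior K" for x y
  proof -
    have "0 \<le> b \<bullet> (y - transpose B *v x)"
      using that by (intro b(2)) (auto simp: S_def)
    then show ?thesis
      by (simp add: inner_diff_right inner_commute[of b "transpose B *v x"]
          inner_transpose_matrix_vector del: transpose_matrix_vector)
  qed
  \<comment> \<open>The inequality passes to the boundary by closedness, first in \<open>x\<close>,
    then in \<open>y\<close>.\<close>
  have le': "(B *v b) \<bullet> x \<le> b \<bullet> y" if "x \<in> K" "y \<in> interior K" for x y
    using subset_closed_if_interior_subset[of "{x. (B *v b) \<bullet> x \<le> b \<bullet> y}"] le that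
    by (auto simp: closed_halfspace_le)
  have le'': "(B *v b) \<bullet> x \<le> b \<bullet> y" if "x \<in> K" "y \<in> K" for x y
    using subset_closed_if_interior_subset[of "{y. b \<bullet> y \<ge> (B *v b) \<bullet> x}"] le' that
    by (auto simp: closed_halfspace_ge)
  \<comment> \<open>Self-duality turns the case \<open>x = 0\<close> into \<open>b \<in> K\<close>,
    and the case \<open>y = 0\<close> below into \<open>- (B *v b) \<in> K\<close>.\<close>
  have "b \<in> K"
    using le''[OF zero_mem] by (intro mem_if_inner_nonneg) (simp add: inner_commute)
  moreover have "- (B *v b) \<in> K"
    using le''[OF _ zero_mem] by (intro mem_if_inner_nonneg) (simp add: inner_commute)
  ultimately show "\<exists>u\<in>K - {0}. - (B *v u) \<in> K"
    using b(1) by blast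
qed

section \<open>The minimax principle\<close>

text \<open>The denominator \<open>u \<bullet> v\<close> is positive and can be cleared; what
  remains is nonnegativity against all interior points, which by density and self-duality is
  membership in \<open>K\<close>.\<close>

lemma le_INF_lam_iff:
  assumes "u \<in> K - {0}"
  shows "ereal t \<le> (INF v\<in>interior K. ereal (lam A u v)) \<longleftrightarrow> A *v u - t *\<^sub>R u \<in> K"
proof -
  have "t \<le> lam A u v \<longleftrightarrow> 0 \<le> v \<bullet> (A *v u - t *\<^sub>R u)" if "v \<in> interior K" for v
    using inner_pos_punctured[OF assms that]
    by (simp add: lam_def pos_le_divide_eq inner_diff_right inner_commute)
  then have "ereal t \<le> (INF v\<in>interior K. ereal (lam A u v)) \<longleftrightarrow>
      (\<forall>v\<in>interior K. 0 \<le> v \<bullet> (A *v u - t *\<^sub>R u))"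
    by (simp add: le_INF_iff)
  also have "\<dots> \<longleftrightarrow> A *v u - t *\<^sub>R u \<in> K"
    using inner_nonneg interior_subset mem_if_inner_interior_nonneg by blast
  finally show ?thesis .
qed

lemma SUP_lam_le:
  assumes "v \<in> interior K" "t *\<^sub>R v - transpose A *v v \<in> K"
  shows "(SUP u\<in>K - {0}. ereal (lam A u v)) \<le> ereal t"
proof (rule SUP_least)
  fix u assume u: "u \<in> K - {0}"
  then have "0 \<le> (t *\<^sub>R v - transpose A *v v) \<bullet> u"
    using assms inner_nonneg by blast
  then have "(A *v u) \<bullet> v \<le> t * (u \<bullet> v)"
    by (simp add: inner_diff_left inner_transpose_matrix_vector inner_commute[of v u]
        del: transpose_matrix_vector)
  then show "ereal (lam A u v) \<le> ereal t"
    using inner_pos_punctured[OF u assms(1)] by (simp add: lam_def pos_divide_le_eq)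
qed

lemma le_sup_inf:
  assumes "u \<in> K - {0}" "A *v u - t *\<^sub>R u \<in> K"
  shows "ereal t \<le> sup_inf A (K - {0}) (interior K)"
  unfolding sup_inf_def using assms by (intro SUP_upper2[OF assms(1)]) (simp add: le_INF_lam_iff)

lemma inf_sup_le:
  assumes "v \<in> interior K" "t *\<^sub>R v - transpose A *v v \<in> K"
  shows "inf_sup A (K - {0}) (interior K) \<le> ereal t"
  unfolding inf_sup_def by (intro INF_lower2[OF assms(1)] SUP_lam_le assms)

text \<open>The theorem of the alternative for the matrix
  \<open>t *\<^sub>R mat 1 - A\<close>.\<close>

lemma quasi_eigenvalue_alternative:
  fixes A :: "real^'n^'n"
  shows "(\<exists>u\<in>K - {0}. A *v u - t *\<^sub>R u \<in> K) \<or>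
    (\<exists>v\<in>interior K. t *\<^sub>R v - transpose A *v v \<in> interior K)"
proof -
  have "transpose (t *\<^sub>R mat 1 - A) = t *\<^sub>R mat 1 - transpose A"
    by (auto simp: vec_eq_iff transpose_def mat_def)
  then show ?thesis
    using theorem_of_alternative[of "t *\<^sub>R mat 1 - A"]
    by (simp add: matrix_vector_mult_diff_rdistrib flip: scaleR_matrix_vector_assoc)
qed

text \<open>The second alternative places a vector in the open set \<open>interior K\<close>, so
  \<open>t\<close> can be lowered to \<open>t - e\<close>. The resulting strictness is what later
  gives attainment of the supremum.\<close>

lemma inf_sup_less_if_no_supersolution:
  assumes "\<not> (\<exists>u\<in>K - {0}. A *v u - t *\<^sub>R u \<in> K)"
  shows "inf_sup A (K - {0}) (interior K) < ereal t"
proof -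
  obtain v where v: "v \<in> interior K" "t *\<^sub>R v - transpose A *v v \<in> interior K"
    using assms quasi_eigenvalue_alternative by blast
  obtain e where e: "e > 0" "t *\<^sub>R v - transpose A *v v - e *\<^sub>R v \<in> interior K"
    using v(2) by (rule interior_minus_scaleR)
  then have "(t - e) *\<^sub>R v - transpose A *v v \<in> K"
    using interior_subset by (auto simp: algebra_simps)
  then have "inf_sup A (K - {0}) (interior K) \<le> ereal (t - e)"
    using v(1) by (rule inf_sup_le[rotated])
  also have "\<dots> < ereal t"
    using e(1) by simp
  finally show ?thesis .
qed

text \<open>For an interior \<open>v\<close>, a small multiple of \<open>transpose A *v v\<close>
  can be subtracted without leaving \<open>K\<close>; rescaling gives the bound
  \<open>1 / e\<close>.\<close>

lemma inf_sup_less_infinity: "inf_sup A (K - {0}) (interior K) < \<infinity>"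
proof -
  obtain v where v: "v \<in> interior K"
    using solid by blast
  then obtain e where e: "e > 0" "v - e *\<^sub>R (transpose A *v v) \<in> interior K"
    by (rule interior_minus_scaleR)
  have "(1 / e) *\<^sub>R v - transpose A *v v \<in> K"
  proof (rule mem_if_inner_nonneg)
    fix w assume "w \<in> K"
    then have "0 \<le> w \<bullet> (v - e *\<^sub>R (transpose A *v v))"
      using e interior_subset inner_nonneg by blast
    then show "0 \<le> w \<bullet> ((1 / e) *\<^sub>R v - transpose A *v v)"
      using e(1) by (simp add: inner_diff_right field_simps)
  qed
  with v have "inf_sup A (K - {0}) (interior K) \<le> ereal (1 / e)"
    by (rule inf_sup_le)
  then show ?thesis
    by (rule le_less_trans) simp
qed

lemma sup_inf_greater_minus_infinity: "- \<infinity> < sup_inf A (K - {0}) (interior K)"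
proof -
  obtain u where u: "u \<in> interior K"
    using solid by blast
  \<comment> \<open>The direction is \<open>- (A *v u)\<close>, so that \<open>u\<close> plus a
    small multiple of \<open>A *v u\<close> stays in the cone; this gives the lower bound
    \<open>- 1 / e\<close>.\<close>
  then obtain e where e: "e > 0" "u - e *\<^sub>R - (A *v u) \<in> interior K"
    by (rule interior_minus_scaleR)
  have "A *v u - (- 1 / e) *\<^sub>R u \<in> K"
  proof (rule mem_if_inner_nonneg)
    fix w assume "w \<in> K"
    then have "0 \<le> w \<bullet> (u - e *\<^sub>R - (A *v u))"
      using e interior_subset inner_nonneg by blast
    then show "0 \<le> w \<bullet> (A *v u - (- 1 / e) *\<^sub>R u)"
      using e(1) by (simp add: inner_diff_right inner_add_right field_simps)
  qed
  then have "ereal (- 1 / e) \<le> sup_inf A (K - {0}) (interior K)"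
    using u interior_subset_punctured by (blast intro: le_sup_inf)
  then show ?thesis
    by (rule less_le_trans[rotated]) simp
qed

lemma minimax_principle_punctured_interior: "minimax_principle A (K - {0}) (interior K)"
proof -
  have "inf_sup A (K - {0}) (interior K) \<le> sup_inf A (K - {0}) (interior K)"
  proof (rule ccontr)
    assume "\<not> ?thesis"
    \<comment> \<open>A real \<open>t\<close> inside the gap is contradictory: a supersolution at
      \<open>t\<close> would force \<open>t \<le> sup_inf\<close>, and its absence would force
      \<open>inf_sup < t\<close>.\<close>
    then obtain t where t: "sup_inf A (K - {0}) (interior K) < ereal t"
        "ereal t < inf_sup A (K - {0}) (interior K)"
      using ereal_dense2 by (metis not_le)
    then show False
      using inf_sup_less_if_no_supersolution le_sup_inf by (meson leD less_imp_le)
  qed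
  moreover have "lam_well_defined (K - {0}) (interior K)"
    unfolding lam_well_defined_def using inner_pos_punctured by (metis less_irrefl)
  ultimately show ?thesis
    using inf_sup_less_infinity sup_inf_greater_minus_infinity sup_inf_le_inf_sup
    unfolding minimax_principle_def by (metis antisym)
qed

lemma minimax_principle_interior_punctured: "minimax_principle A (interior K) (K - {0})"
  using minimax_principle_punctured_interior[of "- transpose A"]
  by (simp add: minimax_principle_minus_transpose)

section \<open>Quasi-eigenvalues and quasi-eigenvectors\<close>

lemma open_cone_eq: "open_cone (K - {0}) = interior K"
  using zero_mem by (simp add: open_cone_def full_cone_def insert_absorb)

lemma upper_quasi_eigenvalue_real:
  obtains t where "upper_quasi_eigenvalue A (K - {0}) = ereal t"
  using sup_inf_greater_minus_infinity[of A] inf_sup_less_infinity[of A]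
    sup_inf_le_inf_sup[of A "K - {0}" "interior K"]
  unfolding upper_quasi_eigenvalue_def open_cone_eq
  by (cases "sup_inf A (K - {0}) (interior K)") auto

lemma right_quasi_eigenvector_exists: "\<exists>u. right_quasi_eigenvector A (K - {0}) u"
proof -
  obtain t where t: "upper_quasi_eigenvalue A (K - {0}) = ereal t"
    by (rule upper_quasi_eigenvalue_real)
  then have "inf_sup A (K - {0}) (interior K) = ereal t"
    using minimax_principle_punctured_interior
    by (simp add: minimax_principle_def upper_quasi_eigenvalue_def open_cone_eq)
  \<comment> \<open>At the common value \<open>t\<close> itself, lack of a supersolution would give
    \<open>inf_sup < t\<close>; hence one exists, and it attains the supremum.\<close>
  then obtain u where u: "u \<in> K - {0}" "A *v u - t *\<^sub>R u \<in> K"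
    using inf_sup_less_if_no_supersolution by (metis less_irrefl)
  have "(INF v\<in>interior K. ereal (lam A u v)) \<le> upper_quasi_eigenvalue A (K - {0})"
    using u(1) unfolding upper_quasi_eigenvalue_def sup_inf_def open_cone_eq by (rule SUP_upper)
  then show ?thesis
    using u t le_INF_lam_iff[OF u(1)] unfolding right_quasi_eigenvector_def open_cone_eq
    by (metis antisym)
qed

lemma right_quasi_eigenvector_supersolution:
  assumes "right_quasi_eigenvector A (K - {0}) u" "upper_quasi_eigenvalue A (K - {0}) = ereal t"
  shows "A *v u - t *\<^sub>R u \<in> K"
  using assms le_INF_lam_iff[of u t A] by (auto simp: right_quasi_eigenvector_def open_cone_eq)

text \<open>An interior maximizer keeps the outer supremum from dropping when it is restricted to
  the interior, while \<open>inf_sup\<close> can only decrease. Weak duality then closes the chain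
  of inequalities.\<close>

lemma interior_right_quasi_eigenvector:
  assumes "right_quasi_eigenvector A (K - {0}) u" "u \<in> interior K"
  shows "minimax_principle A (interior K) (interior K) \<and>
    upper_quasi_eigenvalue A (K - {0}) = sup_inf A (interior K) (interior K)"
proof -
  let ?q = "upper_quasi_eigenvalue A (K - {0})"
  have mm: "lam_well_defined (K - {0}) (interior K)" "- \<infinity> < ?q" "?q < \<infinity>"
      "?q = inf_sup A (K - {0}) (interior K)"
    using minimax_principle_punctured_interior[of A]
    by (auto simp: minimax_principle_def upper_quasi_eigenvalue_def open_cone_eq)
  have "?q \<le> sup_inf A (interior K) (interior K)"
    using assms unfolding right_quasi_eigenvector_def open_cone_eq
    by (auto simp: sup_inf_def intro: SUP_upper)
  moreover have "inf_sup A (interior K) (interior K) \<le> ?q"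
    unfolding mm(4) inf_sup_def
    by (intro INF_superset_mono SUP_subset_mono interior_subset_punctured) auto
  ultimately have "sup_inf A (interior K) (interior K) = ?q"
      "inf_sup A (interior K) (interior K) = ?q"
    using sup_inf_le_inf_sup[of A "interior K" "interior K"] by auto
  moreover have "lam_well_defined (interior K) (interior K)"
    using mm(1) interior_subset_punctured by (auto simp: lam_well_defined_def)
  ultimately show ?thesis
    using mm by (simp add: minimax_principle_def)
qed

lemma eq_zero_if_inner_interior_eq_zero: "x \<in> K \<Longrightarrow> y \<in> interior K \<Longrightarrow> x \<bullet> y = 0 \<Longrightarrow> x = 0"
  using inner_pos by (metis less_irrefl)

end

theorem theorem1p1:
  fixes A :: "real^'n^'n" and C :: "(real^'n) set"
  assumes "C \<in> punctured_cones"
  shows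
    "(minimax_principle A C (open_cone C) \<and> minimax_principle A (open_cone C) C)
     \<and> ((\<exists>u. right_quasi_eigenvector A C u) \<and> (\<exists>v. left_quasi_eigenvector A C v))
     \<and> ((\<forall>u. right_quasi_eigenvector A C u \<and> u \<in> open_cone C \<longrightarrow>
            minimax_principle A (open_cone C) (open_cone C) \<and>
            upper_quasi_eigenvalue A C = lam_C A C \<and>
            lam_C A C = inf_sup A (open_cone C) (open_cone C)) \<and>
        (\<forall>v. left_quasi_eigenvector A C v \<and> v \<in> open_cone C \<longrightarrow>
            minimax_principle A (open_cone C) (open_cone C) \<and>
            lower_quasi_eigenvalue A C = lam_C A C \<and>
            lam_C A C = inf_sup A (open_cone C) (open_cone C)))
     \<and> (\<forall>u v. right_quasi_eigenvector A C u \<and> u \<in> open_cone C \<and>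
               left_quasi_eigenvector A C v \<and> v \<in> open_cone C \<longrightarrow>
            lam_C A C = ereal (lam A u v) \<and>
            is_eigenvalue A (lam A u v) \<and>
            right_eigenvector A (lam A u v) u \<and>
            left_eigenvector A (lam A u v) v)"
proof -
  obtain K where K: "K \<in> self_dual_solid_cones" and C: "C = K - {0}"
    using assms by (auto simp: punctured_cones_def)
  interpret self_dual_solid_cone K
    using K by unfold_locales (auto simp: self_dual_solid_cones_def)
  have O: "open_cone C = interior K"
    by (simp add: C open_cone_eq)
  have lower: "upper_quasi_eigenvalue (- transpose A) C = - lower_quasi_eigenvalue A C"
    by (simp add: upper_quasi_eigenvalue_def lower_quasi_eigenvalue_def sup_inf_minus_transpose)
  have right: "minimax_principle A (interior K) (interior K) \<and>
      upper_quasi_eigenvalue A C = lam_C A C \<and>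
      lam_C A C = inf_sup A (interior K) (interior K)"
    if "right_quasi_eigenvector A C u" "u \<in> interior K" for u
    using interior_right_quasi_eigenvector[of A u] that
    unfolding C open_cone_eq lam_C_def minimax_principle_def by metis
  have left: "minimax_principle A (interior K) (interior K) \<and>
      lower_quasi_eigenvalue A C = lam_C A C \<and>
      lam_C A C = inf_sup A (interior K) (interior K)"
    if "left_quasi_eigenvector A C v" "v \<in> interior K" for v
  proof -
    have "minimax_principle (- transpose A) (interior K) (interior K)"
        "upper_quasi_eigenvalue (- transpose A) C = sup_inf (- transpose A) (interior K) (interior K)"
      using interior_right_quasi_eigenvector[of "- transpose A" v] that
      by (simp_all add: C right_quasi_eigenvector_minus_transpose)
    then show ?thesis
      by (simp add: minimax_principle_minus_transpose lower sup_inf_minus_transpose O lam_C_def)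
        (simp add: minimax_principle_def)
  qed
  have eigen: "lam_C A C = ereal (lam A u v) \<and> is_eigenvalue A (lam A u v) \<and>
      right_eigenvector A (lam A u v) u \<and> left_eigenvector A (lam A u v) v"
    if u: "right_quasi_eigenvector A C u" "u \<in> interior K"
      and v: "left_quasi_eigenvector A C v" "v \<in> interior K" for u v
  proof -
    obtain t where t: "upper_quasi_eigenvalue A C = ereal t"
      unfolding C by (rule upper_quasi_eigenvalue_real)
    then have lam_C: "lam_C A C = ereal t" and "lower_quasi_eigenvalue A C = ereal t"
      using right[OF u] left[OF v] by auto
    \<comment> \<open>Since \<open>v\<close> is a right quasi-eigenvector of
      \<open>- transpose A\<close> with value \<open>- t\<close>, the supersolution property applies
      to it as well.\<close>
    then have "upper_quasi_eigenvalue (- transpose A) C = ereal (- t)"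
      by (simp add: lower)
    then have "(- transpose A) *v v - (- t) *\<^sub>R v \<in> K"
      using v(1) unfolding C right_quasi_eigenvector_minus_transpose[symmetric]
      by (rule right_quasi_eigenvector_supersolution[rotated])
    then have vK: "t *\<^sub>R v - transpose A *v v \<in> K"
      by (simp add: uminus_matrix_vector_mult)
    have uK: "A *v u - t *\<^sub>R u \<in> K"
      using u(1) t unfolding C by (rule right_quasi_eigenvector_supersolution)
    \<comment> \<open>The residuals of \<open>u\<close> and \<open>v\<close> lie in
      \<open>K\<close>, so both pairings are nonnegative; being opposite numbers, they vanish. An
      element of \<open>K\<close> orthogonal to an interior point is 0, so both residuals are
      0.\<close>
    have opp: "(A *v u - t *\<^sub>R u) \<bullet> v = - ((t *\<^sub>R v - transpose A *v v) \<bullet> u)"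
      by (simp add: inner_diff_left inner_transpose_matrix_vector inner_commute[of v u]
          del: transpose_matrix_vector)
    moreover have "0 \<le> (A *v u - t *\<^sub>R u) \<bullet> v" "0 \<le> (t *\<^sub>R v - transpose A *v v) \<bullet> u"
      using uK vK u(2) v(2) inner_nonneg interior_subset by blast+
    ultimately have zero: "(A *v u - t *\<^sub>R u) \<bullet> v = 0" "(t *\<^sub>R v - transpose A *v v) \<bullet> u = 0"
      by linarith+
    then have Au: "A *v u = t *\<^sub>R u" and Av: "transpose A *v v = t *\<^sub>R v"
      using eq_zero_if_inner_interior_eq_zero uK vK u(2) v(2) by fastforce+
    have "u \<noteq> 0" "v \<noteq> 0"
      using u(2) v(2) zero_not_interior by auto
    moreover have "lam A u v = t"
      using inner_pos_punctured[OF subsetD[OF interior_subset_punctured u(2)] v(2)]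
      by (simp add: lam_def Au)
    ultimately show ?thesis
      using Au Av lam_C
      by (auto simp: is_eigenvalue_def right_eigenvector_def left_eigenvector_def)
  qed
  show ?thesis
    unfolding O
    using right left eigen right_quasi_eigenvector_exists[of A]
      right_quasi_eigenvector_exists[of "- transpose A"]
      minimax_principle_punctured_interior[of A] minimax_principle_interior_punctured[of A]
    unfolding C right_quasi_eigenvector_minus_transpose by blast
qed

end
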